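(* Regard the real unit interval $[0,1]\subseteq\mathbb{R}$ as an effect algebra by declaring $a\perp b$ if and only if $a+b\le 1$, and in this case $a\oplus b=a+b$. Then there is a unique sequential product on the effect algebra $([0,1],0,1,\oplus)$.
   Context: An effect algebra is a system $(E,0,1,\oplus)$ where $0\neq 1\in E$ and $\oplus$ is a partial binary operation on $E$ such that: (A1) if $a\oplus b$ is defined then $b\oplus a$ is defined and $b\oplus a=a\oplus b$; (A2) if $a\oplus b$ and $(a\oplus b)\oplus c$ are defined, then $b\oplus c$ and $a\oplus(b\oplus c)$ are defined and $a\oplus(b\oplus c)=(a\oplus b)\oplus c$; (A3) for every $a\in E$ there is a unique $a'\in E$ with $a\oplus a'=1$; (A4) if $a\oplus 1$ is defined then $a=0$. We write $a\perp b$ if $a\oplus b$ is defined. For a binary operation $\circ$ on $E$ write $a\mid b$ if $a\circ b=b\circ a$. A sequential product on an effect algebra $E$ is a binary operation $\circ\colon E\times E\to E$ such that: (S1) if $b\perp c$ then $a\circ b\perp a\circ c$ and $a\circ(b\oplus c)=a\circ b\oplus a\circ c$; (S2) $1\circ a=a$ for all $a$; (S3) if $a\circ b=0$ then $a\mid b$; (S4) if $a\mid b$ then $a\mid b'$ and $a\circ(b\circ c)=(a\circ b)\circ c$ for all $c$; (S5) if $c\mid a$ and $c\mid b$ then $c\mid a\circ b$ and, when $a\perp b$, $c\mid(a\oplus b)$. *)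

theory Defs
  imports Complex_Main "HOL-Library.FuncSet"
begin

text \<open>
  The partial operation is option-valued, with \<open>None\<close> meaning undefined. Only its restriction
  to the carrier \<open>E\<close> is constrained.
\<close>

locale effect_algebra =
  fixes E :: "'a set"
    and zer :: 'a
    and uni :: 'a
    and osum :: "'a \<Rightarrow> 'a \<Rightarrow> 'a option"
  assumes zer_in: "zer \<in> E"
    and uni_in: "uni \<in> E"
    and zer_neq_uni: "zer \<noteq> uni"
    and osum_in: "\<lbrakk>a \<in> E; b \<in> E; osum a b = Some c\<rbrakk> \<Longrightarrow> c \<in> E"
    and A1: "\<lbrakk>a \<in> E; b \<in> E; osum a b = Some c\<rbrakk> \<Longrightarrow> osum b a = Some c"
    and A2: "\<lbrakk>a \<in> E; b \<in> E; c \<in> E; osum a b = Some d; osum d c = Some e\<rbrakk>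
              \<Longrightarrow> \<exists>f. osum b c = Some f \<and> osum a f = Some e"
    and A3: "a \<in> E \<Longrightarrow> \<exists>!a'. a' \<in> E \<and> osum a a' = Some uni"
    and A4: "\<lbrakk>a \<in> E; osum a uni \<noteq> None\<rbrakk> \<Longrightarrow> a = zer"
begin

definition perp :: "'a \<Rightarrow> 'a \<Rightarrow> bool"  (infix "\<bottom>\<^sub>E" 50)
  where "a \<bottom>\<^sub>E b \<longleftrightarrow> osum a b \<noteq> None"

text \<open>Meaningful only when \<open>a \<bottom>\<^sub>E b\<close>.\<close>

definition oplus :: "'a \<Rightarrow> 'a \<Rightarrow> 'a"  (infixl "\<oplus>\<^sub>E" 65)
  where "a \<oplus>\<^sub>E b = the (osum a b)"

definition orthosupplement :: "'a \<Rightarrow> 'a"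
  where "orthosupplement a = (THE a'. a' \<in> E \<and> osum a a' = Some uni)"

end

text \<open>
  Values of \<open>sprod\<close> off \<open>E\<close> are unconstrained, so uniqueness claims have to be made among the
  extensional functions \<open>E \<rightarrow>\<^sub>E E \<rightarrow>\<^sub>E E\<close>, which correspond to the maps from \<open>E \<times> E\<close> to \<open>E\<close>.
\<close>

locale sequential_product = effect_algebra E zer uni osum
  for E :: "'a set" and zer :: 'a and uni :: 'a and osum :: "'a \<Rightarrow> 'a \<Rightarrow> 'a option" +
  fixes sprod :: "'a \<Rightarrow> 'a \<Rightarrow> 'a"  (infixl "\<circ>\<^sub>E" 70)
    and commutes :: "'a \<Rightarrow> 'a \<Rightarrow> bool"  (infix "\<bar>\<^sub>E" 50)
  defines "a \<bar>\<^sub>E b \<equiv> a \<circ>\<^sub>E b = b \<circ>\<^sub>E a"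
  assumes sprod_in: "sprod \<in> E \<rightarrow> E \<rightarrow> E"
    and S1: "\<lbrakk>a \<in> E; b \<in> E; c \<in> E; b \<bottom>\<^sub>E c\<rbrakk>
              \<Longrightarrow> a \<circ>\<^sub>E b \<bottom>\<^sub>E a \<circ>\<^sub>E c \<and> a \<circ>\<^sub>E (b \<oplus>\<^sub>E c) = a \<circ>\<^sub>E b \<oplus>\<^sub>E a \<circ>\<^sub>E c"
    and S2: "a \<in> E \<Longrightarrow> uni \<circ>\<^sub>E a = a"
    and S3: "\<lbrakk>a \<in> E; b \<in> E; a \<circ>\<^sub>E b = zer\<rbrakk> \<Longrightarrow> a \<bar>\<^sub>E b"
    and S4: "\<lbrakk>a \<in> E; b \<in> E; a \<bar>\<^sub>E b\<rbrakk>
              \<Longrightarrow> a \<bar>\<^sub>E orthosupplement b \<and> (\<forall>c\<in>E. a \<circ>\<^sub>E (b \<circ>\<^sub>E c) = (a \<circ>\<^sub>E b) \<circ>\<^sub>E c)"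
    and S5: "\<lbrakk>a \<in> E; b \<in> E; c \<in> E; c \<bar>\<^sub>E a; c \<bar>\<^sub>E b\<rbrakk>
              \<Longrightarrow> c \<bar>\<^sub>E a \<circ>\<^sub>E b \<and> (a \<bottom>\<^sub>E b \<longrightarrow> c \<bar>\<^sub>E a \<oplus>\<^sub>E b)"

definition unit_osum :: "real \<Rightarrow> real \<Rightarrow> real option"
  where "unit_osum a b = (if a + b \<le> 1 then Some (a + b) else None)"

end

theory Submission
  imports Defs
begin

text \<open>
  For fixed \<open>a\<close> the map \<open>b \<mapsto> a \<circ> b\<close> is additive and nonnegative on \<open>[0,1]\<close>, hence linear:
  \<open>a \<circ> b = b * (a \<circ> 1)\<close>. Additivity gives \<open>a \<circ> 0 = 0\<close>, so \<open>a\<close> commutes with \<open>0\<close> by (S3), hence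
  with \<open>0' = 1\<close> by (S4), and (S2) yields \<open>a \<circ> 1 = 1 \<circ> a = a\<close>. So the product is multiplication.
\<close>

text \<open>Additivity fixes \<open>f\<close> at the grid points \<open>j / n\<close>, and
  nonnegativity makes it monotone. Squeezing \<open>x\<close> between neighbouring grid points
  bounds \<open>n * \<bar>f x - x * f 1\<bar>\<close> by \<open>f 1\<close> for every
  \<open>n > 0\<close>, so the difference vanishes.\<close>

lemma additive_nonneg_unit_interval_linear:
  fixes f :: "real \<Rightarrow> real"
  assumes add: "\<And>x y. \<lbrakk>0 \<le> x; 0 \<le> y; x + y \<le> 1\<rbrakk> \<Longrightarrow> f (x + y) = f x + f y"
    and nonneg: "\<And>x. \<lbrakk>0 \<le> x; x \<le> 1\<rbrakk> \<Longrightarrow> 0 \<le> f x"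
    and x: "0 \<le> x" "x \<le> 1"
  shows "f x = x * f 1"
proof (cases "x = 1")
  case False
  with x have "x < 1" by simp
  have zero: "f 0 = 0"
    using add[of 0 0] by simp
  have mult: "f (real k * y) = real k * f y" if "0 \<le> y" "real k * y \<le> 1" for k y
    using that
  proof (induction k)
    case (Suc k)
    have "real k * y + y \<le> 1"
      using Suc.prems by (simp add: algebra_simps)
    then show ?case
      using Suc.IH add[of "real k * y" y] \<open>0 \<le> y\<close> by (simp add: algebra_simps)
  qed (simp add: zero)
  have mono: "f y \<le> f z" if "0 \<le> y" "y \<le> z" "z \<le> 1" for y z
    using add[of y "z - y"] nonneg[of "z - y"] that by simp
  have approx: "real n * \<bar>f x - x * f 1\<bar> \<le> f 1" if "n > 0" for n
  proof -
    define k where "k = nat \<lfloor>real n * x\<rfloor>"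
    have k: "real k \<le> real n * x" "real n * x < real k + 1"
      using x by (auto simp: k_def)
    \<comment> \<open>Strictness gives \<open>k < n\<close>, so the upper grid point
      \<open>(k + 1) / n\<close> stays in [0,1]; this is why \<open>x = 1\<close> is split
      off.\<close>
    have "real n * x < real n"
      using \<open>x < 1\<close> that by simp
    with k have "k < n"
      by linarith
    \<comment> \<open>Both sides equal \<open>n * j * f (1 / n)\<close>, since
      \<open>f 1 = n * f (1 / n)\<close>.\<close>
    have step: "real n * f (real j / real n) = real j * f 1" if "j \<le> n" for j
      using mult[of "1 / real n" j] mult[of "1 / real n" n] that \<open>n > 0\<close>
      by (simp add: field_simps)
    have "f (real k / real n) \<le> f x"
      using k x \<open>n > 0\<close> by (intro mono) (auto simp: field_simps)
    then have lower: "real k * f 1 \<le> real n * f x"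
      using step[of k] \<open>k < n\<close> mult_left_mono[of "f (real k / real n)" "f x" "real n"] by simp
    have "f x \<le> f (real (Suc k) / real n)"
      using k x \<open>k < n\<close> by (intro mono) (auto simp: field_simps)
    then have upper: "real n * f x \<le> (real k + 1) * f 1"
      using step[of "Suc k"] \<open>k < n\<close> mult_left_mono[of "f x" "f (real (Suc k) / real n)" "real n"]
      by (simp add: add.commute)
    \<comment> \<open>Thus \<open>n * x * f 1\<close> lies in the same interval of length
      \<open>f 1\<close> as \<open>n * f x\<close>.\<close>
    have "real k * f 1 \<le> real n * x * f 1" "real n * x * f 1 \<le> (real k + 1) * f 1"
      using k nonneg[of 1] by (auto intro!: mult_right_mono)
    with lower upper have "\<bar>real n * (f x - x * f 1)\<bar> \<le> f 1"
      by (simp add: algebra_simps abs_le_iff)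
    then show ?thesis
      by (simp add: abs_mult)
  qed
  show ?thesis
  proof (rule ccontr)
    assume "f x \<noteq> x * f 1"
    then have "0 < \<bar>f x - x * f 1\<bar>" by simp
    then obtain n where n: "f 1 < real n * \<bar>f x - x * f 1\<bar>"
      using reals_Archimedean3 by blast
    \<comment> \<open>For \<open>n = 0\<close> the choice of \<open>n\<close> would give
      \<open>f 1 < 0\<close>.\<close>
    have "n \<noteq> 0"
      using n nonneg[of 1] by (intro notI) simp
    with approx[of n] n show False by simp
  qed
qed simp

lemma unit_osum_eq_Some: "unit_osum a b = Some c \<longleftrightarrow> a + b \<le> 1 \<and> c = a + b"
  by (auto simp: unit_osum_def)

lemma unit_osum_eq_None: "unit_osum a b = None \<longleftrightarrow> \<not> a + b \<le> 1"
  by (simp add: unit_osum_def)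

interpretation unit_interval: effect_algebra "{0..1}" 0 1 unit_osum
proof
  fix a :: real
  assume "a \<in> {0..1}"
  then show "\<exists>!a'. a' \<in> {0..1} \<and> unit_osum a a' = Some 1"
    by (intro ex1I[of _ "1 - a"]) (auto simp: unit_osum_eq_Some)
qed (auto simp: unit_osum_eq_Some unit_osum_eq_None)

lemma unit_interval_perp: "unit_interval.perp a b \<longleftrightarrow> a + b \<le> 1"
  by (simp add: unit_interval.perp_def unit_osum_def)

lemma unit_interval_oplus: "a + b \<le> 1 \<Longrightarrow> unit_interval.oplus a b = a + b"
  by (simp add: unit_interval.oplus_def unit_osum_def)

lemma unit_interval_orthosupplement:
  "a \<in> {0..1} \<Longrightarrow> unit_interval.orthosupplement a = 1 - a"
  unfolding unit_interval.orthosupplement_def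
  by (rule the_equality) (auto simp: unit_osum_eq_Some)

text \<open>Existence: the axioms reduce to distributivity, associativity and commutativity of real
  multiplication. Only values on the carrier are prescribed, so the result also covers the
  extensional restriction of multiplication.\<close>

lemma sequential_product_unit_interval_mult:
  assumes "\<And>a b. \<lbrakk>a \<in> {0..1}; b \<in> {0..1}\<rbrakk> \<Longrightarrow> s a b = a * b"
  shows "sequential_product {0..1} 0 1 unit_osum s"
proof -
  have mult_in: "a * b \<in> {0..1}" if "a \<in> {0..1}" "b \<in> {0..1}" for a b :: real
    using that by (auto simp: mult_le_one)
  have perp: "a * b + a * c \<le> 1" if "a \<in> {0..1}" "b + c \<le> 1" "b \<in> {0..1}" "c \<in> {0..1}"
    for a b c :: real
    using that mult_in[of a "b + c"] by (auto simp: distrib_left)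
  show ?thesis
  proof
    show "s \<in> {0..1} \<rightarrow> {0..1} \<rightarrow> {0..1}"
      using assms mult_in by auto
  next
    fix a b c :: real
    assume "a \<in> {0..1}" "b \<in> {0..1}" "c \<in> {0..1}" "unit_interval.perp b c"
    then show "unit_interval.perp (s a b) (s a c) \<and>
        s a (unit_interval.oplus b c) = unit_interval.oplus (s a b) (s a c)"
      using perp[of a b c] assms
      by (simp add: unit_interval_perp unit_interval_oplus distrib_left)
  next
    fix a b :: real
    assume "a \<in> {0..1}" "b \<in> {0..1}"
    then show "s a (unit_interval.orthosupplement b) = s (unit_interval.orthosupplement b) a \<and>
        (\<forall>c\<in>{0..1}. s a (s b c) = s (s a b) c)"
      using assms mult_in by (simp add: unit_interval_orthosupplement del: atLeastAtMost_iff) simp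
  next
    fix a b c :: real
    assume "a \<in> {0..1}" "b \<in> {0..1}" "c \<in> {0..1}"
    then show "s c (s a b) = s (s a b) c \<and>
        (unit_interval.perp a b \<longrightarrow>
          s c (unit_interval.oplus a b) = s (unit_interval.oplus a b) c)"
      using assms mult_in[of a b] by (simp add: unit_interval_perp unit_interval_oplus)
  qed (auto simp: assms)
qed

lemma sequential_product_unit_interval_eq_mult:
  assumes "sequential_product {0..1} 0 1 unit_osum s"
    and a: "a \<in> {0..1}" and b: "b \<in> {0..1}"
  shows "s a b = a * b"
proof -
  interpret sequential_product "{0..1}" 0 1 unit_osum s "\<lambda>a b. s a b = s b a"
    using assms(1) by simp_all
  have add: "s a (x + y) = s a x + s a y" if "0 \<le> x" "0 \<le> y" "x + y \<le> 1" for x y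
    using S1[of a x y] a that by (simp add: unit_interval_perp unit_interval_oplus)
  \<comment> \<open>The order enters through the codomain: values in [0,1] are nonnegative, which
    rules out wild additive functions.\<close>
  have nonneg: "0 \<le> s a x" if "0 \<le> x" "x \<le> 1" for x
    using sprod_in a that by (auto simp: Pi_iff)
  have "s a 0 = 0"
    using add[of 0 0] by simp
  then have "s a 0 = s 0 a"
    using S3[of a 0] a by simp
  then have "s a (unit_interval.orthosupplement 0) = s (unit_interval.orthosupplement 0) a"
    using S4[of a 0] a unit_interval.zer_in by blast
  then have "s a 1 = a"
    using S2[OF a] by (simp add: unit_interval_orthosupplement)
  moreover have "s a b = b * s a 1"
    by (rule additive_nonneg_unit_interval_linear) (use add nonneg b in auto)
  ultimately show ?thesis
    by simp
qed

theorem theorem4p1: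
  shows "effect_algebra {0..1} 0 1 unit_osum \<and>
    (\<exists>!sprod. sprod \<in> {0..1} \<rightarrow>\<^sub>E {0..1} \<rightarrow>\<^sub>E {0..1} \<and>
       sequential_product {0..1} 0 1 unit_osum sprod)"
proof
  show "effect_algebra {0..1} 0 1 unit_osum"
    by (rule unit_interval.effect_algebra_axioms)
next
  \<comment> \<open>Multiplication is restricted in both arguments so that it is extensional at both
    levels.\<close>
  define p :: "real \<Rightarrow> real \<Rightarrow> real" where "p = (\<lambda>a\<in>{0..1}. \<lambda>b\<in>{0..1}. a * b)"
  show "\<exists>!sprod. sprod \<in> {0..1} \<rightarrow>\<^sub>E {0..1} \<rightarrow>\<^sub>E {0..1} \<and>
       sequential_product {0..1} 0 1 unit_osum sprod"
  proof (rule ex1I[of _ p], intro conjI)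
    show p_in: "p \<in> {0..1} \<rightarrow>\<^sub>E {0..1} \<rightarrow>\<^sub>E {0..1}"
      by (auto simp: p_def mult_le_one)
    show "sequential_product {0..1} 0 1 unit_osum p"
      by (rule sequential_product_unit_interval_mult) (simp add: p_def)
    fix q
    assume q: "q \<in> {0..1} \<rightarrow>\<^sub>E {0..1} \<rightarrow>\<^sub>E {0..1} \<and> sequential_product {0..1} 0 1 unit_osum q"
    show "q = p"
    \<comment> \<open>Extensionality is used twice, as \<open>q a\<close> and \<open>p a\<close> are
      themselves extensional functions; what remains is agreement on the carrier.\<close>
    proof (rule PiE_ext[of _ "{0..1}" "\<lambda>_. {0..1} \<rightarrow>\<^sub>E {0..1}"])
      fix a :: real
      assume a: "a \<in> {0..1}"
      show "q a = p a"
      proof (rule PiE_ext[of _ "{0..1}" "\<lambda>_. {0..1}"])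
        fix b :: real
        assume "b \<in> {0..1}"
        then show "q a b = p a b"
          using a q sequential_product_unit_interval_eq_mult[of q a b] by (simp add: p_def)
      qed (use a q p_in PiE_mem in blast)+
    qed (use q p_in in auto)
  qed
qed

end
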